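(* Let $T_k$ be the regular tree of degree $k\ge 2$ with its path metric. Then $\mathcal{K}(T_k)$ is plastic. Moreover, every nonexpansive bijection $F\colon\mathcal{K}(T_k)\to\mathcal{K}(T_k)$ maps the set of singletons onto itself, and there is an isometry $f$ of $T_k$ with $F(\{v\})=\{f(v)\}$ for every vertex $v$.
   Context: $T_k$ is the (infinite) tree, i.e. connected acyclic simple graph, in which every vertex has exactly $k$ neighbours; it is identified with its vertex set and equipped with the path metric (minimal length of a walk). $\mathcal{K}(X)$ is the set of nonempty compact subsets of $X$ with the Hausdorff metric (for $T_k$: nonempty finite sets of vertices). A map $f$ is nonexpansive if $d(f(x),f(y))\le d(x,y)$ for all $x,y$. A metric space is plastic if every bijective nonexpansive self-map is an isometry. *)

theory Defs
  imports "HOL-Analysis.Analysis" "Graph_Theory.Digraph_Component"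
begin

section \<open>Nonexpansive maps, isometries, plasticity\<close>

definition nonexpansive_map :: "'a metric \<Rightarrow> 'b metric \<Rightarrow> ('a \<Rightarrow> 'b) \<Rightarrow> bool" where
  "nonexpansive_map m1 m2 f \<longleftrightarrow>
     f ` mspace m1 \<subseteq> mspace m2 \<and>
     (\<forall>x\<in>mspace m1. \<forall>y\<in>mspace m1. mdist m2 (f x) (f y) \<le> mdist m1 x y)"

text \<open>Isometries are taken to be surjective.\<close>

definition isometry_map :: "'a metric \<Rightarrow> 'b metric \<Rightarrow> ('a \<Rightarrow> 'b) \<Rightarrow> bool" where
  "isometry_map m1 m2 f \<longleftrightarrow>
     bij_betw f (mspace m1) (mspace m2) \<and>
     (\<forall>x\<in>mspace m1. \<forall>y\<in>mspace m1. mdist m2 (f x) (f y) = mdist m1 x y)"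

definition plastic :: "'a metric \<Rightarrow> bool" where
  "plastic m \<longleftrightarrow>
     (\<forall>f. bij_betw f (mspace m) (mspace m) \<and> nonexpansive_map m m f \<longrightarrow> isometry_map m m f)"


section \<open>The hyperspace of nonempty compact sets with the Hausdorff metric\<close>

definition compact_sets :: "'a metric \<Rightarrow> 'a set set" where
  "compact_sets m = {A. A \<noteq> {} \<and> compactin (mtopology_of m) A}"

definition hausdorff_dist :: "'a metric \<Rightarrow> 'a set \<Rightarrow> 'a set \<Rightarrow> real" where
  "hausdorff_dist m A B =
     max (SUP a\<in>A. INF b\<in>B. mdist m a b) (SUP b\<in>B. INF a\<in>A. mdist m a b)"

text \<open>
  The type of metrics requires distances to be nonnegative on the whole underlying type, which
  \<^const>\<open>hausdorff_dist\<close> need not be on empty or unbounded sets; hence the case distinction.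
\<close>

definition hyperspace :: "'a metric \<Rightarrow> 'a set metric" where
  "hyperspace m =
     metric (compact_sets m,
       \<lambda>A B. if A \<in> compact_sets m \<and> B \<in> compact_sets m then hausdorff_dist m A B else 0)"

lemma compact_sets_subset: "A \<in> compact_sets m \<Longrightarrow> A \<subseteq> mspace m"
  using compactin_subset_topspace by (fastforce simp: compact_sets_def)

lemma compact_sets_bounded:
  assumes "A \<in> compact_sets m" "B \<in> compact_sets m"
  obtains D where "\<And>a b. a \<in> A \<Longrightarrow> b \<in> B \<Longrightarrow> mdist m a b \<le> D"
proof -
  interpret Metric_space "mspace m" "mdist m" by simp
  have "compactin mtopology (A \<union> B)"
    using assms by (auto simp: compact_sets_def mtopology_of_def intro: compactin_Un)
  then have "mbounded (A \<union> B)" by (rule compactin_imp_mbounded)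
  then obtain D where "\<forall>x\<in>A \<union> B. \<forall>y\<in>A \<union> B. mdist m x y \<le> D"
    unfolding mbounded_alt by blast
  then show ?thesis using that by blast
qed

lemma Inf_mdist_le: "b \<in> B \<Longrightarrow> (INF b\<in>B. mdist m a b) \<le> mdist m a b"
  by (rule cINF_lower) (auto intro!: bdd_belowI[of _ 0])

lemma Inf_mdist_nonneg: "B \<noteq> {} \<Longrightarrow> 0 \<le> (INF b\<in>B. mdist m a b)"
  by (rule cINF_greatest) auto

lemma Sup_Inf_mdist_upper:
  assumes "A \<in> compact_sets m" "B \<in> compact_sets m" "a \<in> A"
  shows "(INF b\<in>B. mdist m a b) \<le> (SUP a\<in>A. INF b\<in>B. mdist m a b)"
proof -
  obtain D where D: "\<And>a b. a \<in> A \<Longrightarrow> b \<in> B \<Longrightarrow> mdist m a b \<le> D"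
    using compact_sets_bounded assms(1,2) by blast
  obtain b where "b \<in> B" using assms(2) by (auto simp: compact_sets_def)
  then have "(INF b\<in>B. mdist m x b) \<le> D" if "x \<in> A" for x
    using D[OF that] Inf_mdist_le[of b B m x] by fastforce
  then have "bdd_above ((\<lambda>a. INF b\<in>B. mdist m a b) ` A)"
    by (auto intro!: bdd_aboveI)
  then show ?thesis using assms(3) by (rule cSUP_upper2) simp
qed

lemma Sup_Inf_mdist_triangle:
  assumes A: "A \<in> compact_sets m" and B: "B \<in> compact_sets m" and C: "C \<in> compact_sets m"
  shows "(SUP a\<in>A. INF c\<in>C. mdist m a c) \<le>
           (SUP a\<in>A. INF b\<in>B. mdist m a b) + (SUP b\<in>B. INF c\<in>C. mdist m b c)"
proof -
  interpret Metric_space "mspace m" "mdist m" by simp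
  have ne: "A \<noteq> {}" "B \<noteq> {}" "C \<noteq> {}" using assms by (auto simp: compact_sets_def)
  have sub: "A \<subseteq> mspace m" "B \<subseteq> mspace m" "C \<subseteq> mspace m"
    using assms by (auto dest: compact_sets_subset)
  let ?h = "SUP b\<in>B. INF c\<in>C. mdist m b c"
  have "(INF c\<in>C. mdist m a c) \<le> (SUP a\<in>A. INF b\<in>B. mdist m a b) + ?h" if a: "a \<in> A" for a
  proof -
    have "(INF c\<in>C. mdist m a c) - ?h \<le> mdist m a b" if b: "b \<in> B" for b
    proof -
      have "(INF c\<in>C. mdist m a c) - mdist m a b \<le> mdist m b c" if c: "c \<in> C" for c
        using Inf_mdist_le[OF c, of m a] triangle[of a b c] a b c sub by fastforce
      then have "(INF c\<in>C. mdist m a c) - mdist m a b \<le> (INF c\<in>C. mdist m b c)"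
        using ne by (intro cINF_greatest) auto
      with Sup_Inf_mdist_upper[OF B C b] show ?thesis by linarith
    qed
    then have "(INF c\<in>C. mdist m a c) - ?h \<le> (INF b\<in>B. mdist m a b)"
      using ne by (intro cINF_greatest) auto
    with Sup_Inf_mdist_upper[OF A B a] show ?thesis by linarith
  qed
  then show ?thesis using ne by (intro cSUP_least) auto
qed

lemma Sup_Inf_mdist_nonneg:
  assumes "A \<in> compact_sets m" "B \<in> compact_sets m"
  shows "0 \<le> (SUP a\<in>A. INF b\<in>B. mdist m a b)"
proof -
  obtain a where "a \<in> A" using assms(1) by (auto simp: compact_sets_def)
  moreover have "B \<noteq> {}" using assms(2) by (auto simp: compact_sets_def)
  ultimately show ?thesis
    using Sup_Inf_mdist_upper[OF assms, of a] Inf_mdist_nonneg[of B m a] by linarith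
qed

lemma Sup_Inf_mdist_zero_imp_subset:
  assumes A: "A \<in> compact_sets m" and B: "B \<in> compact_sets m"
    and le: "(SUP a\<in>A. INF b\<in>B. mdist m a b) \<le> 0"
  shows "A \<subseteq> B"
proof
  interpret Metric_space "mspace m" "mdist m" by simp
  fix a assume a: "a \<in> A"
  show "a \<in> B"
  proof (rule ccontr)
    assume "a \<notin> B"
    have "closedin mtopology B"
      using B compactin_imp_closedin[OF Hausdorff_space_mtopology]
      by (auto simp: compact_sets_def mtopology_of_def)
    then have "openin mtopology (mspace m - B)" by (metis openin_diff openin_topspace topspace_mtopology)
    moreover have am: "a \<in> mspace m" using a A compact_sets_subset by blast
    ultimately obtain r where r: "r > 0" "mball a r \<subseteq> mspace m - B"
      using \<open>a \<notin> B\<close> unfolding openin_mtopology by blast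
    have "r \<le> mdist m a b" if "b \<in> B" for b
    proof (rule ccontr)
      assume "\<not> r \<le> mdist m a b"
      then have "b \<in> mball a r" using am that B compact_sets_subset by fastforce
      with r that show False by blast
    qed
    then have "r \<le> (INF b\<in>B. mdist m a b)"
      using B by (intro cINF_greatest) (auto simp: compact_sets_def)
    with Sup_Inf_mdist_upper[OF A B a] le r show False by linarith
  qed
qed

lemma hausdorff_dist_commute: "hausdorff_dist m A B = hausdorff_dist m B A"
  by (simp add: hausdorff_dist_def max.commute Metric_space.commute[OF Metric_space_mspace_mdist])

lemma hausdorff_dist_self:
  assumes A: "A \<in> compact_sets m"
  shows "hausdorff_dist m A A = 0"
proof -
  interpret Metric_space "mspace m" "mdist m" by simp
  have "(INF b\<in>A. mdist m a b) = 0" if "a \<in> A" for a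
    using Inf_mdist_le[OF that, of m a] Inf_mdist_nonneg[of A m a] that compact_sets_subset[OF A]
    by fastforce
  then have "(SUP a\<in>A. INF b\<in>A. mdist m a b) = 0"
    using A by (simp add: compact_sets_def)
  then show ?thesis
    by (simp add: hausdorff_dist_def commute)
qed

lemma Metric_space_hyperspace:
  "Metric_space (compact_sets m)
     (\<lambda>A B. if A \<in> compact_sets m \<and> B \<in> compact_sets m then hausdorff_dist m A B else 0)"
proof -
  interpret Metric_space "mspace m" "mdist m" by simp
  have hd: "hausdorff_dist m A B =
      max (SUP a\<in>A. INF b\<in>B. mdist m a b) (SUP b\<in>B. INF a\<in>A. mdist m b a)" for A B
    unfolding hausdorff_dist_def by (simp add: commute)
  show ?thesis
  proof
    fix A B
    show "0 \<le> (if A \<in> compact_sets m \<and> B \<in> compact_sets m then hausdorff_dist m A B else 0)"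
      using Sup_Inf_mdist_nonneg[of A m B] by (auto simp: hd)
    show "(if A \<in> compact_sets m \<and> B \<in> compact_sets m then hausdorff_dist m A B else 0) =
          (if B \<in> compact_sets m \<and> A \<in> compact_sets m then hausdorff_dist m B A else 0)"
      using hausdorff_dist_commute by auto
  next
    fix A B assume AB: "A \<in> compact_sets m" "B \<in> compact_sets m"
    have "A = B" if "hausdorff_dist m A B = 0"
      using that Sup_Inf_mdist_zero_imp_subset[of A m B] Sup_Inf_mdist_zero_imp_subset[of B m A] AB
      by (force simp: hd)
    then show "((if A \<in> compact_sets m \<and> B \<in> compact_sets m then hausdorff_dist m A B else 0) = 0)
          = (A = B)"
      using AB hausdorff_dist_self by auto
  next
    fix A B C assume "A \<in> compact_sets m" "B \<in> compact_sets m" "C \<in> compact_sets m"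
    then show "(if A \<in> compact_sets m \<and> C \<in> compact_sets m then hausdorff_dist m A C else 0)
        \<le> (if A \<in> compact_sets m \<and> B \<in> compact_sets m then hausdorff_dist m A B else 0)
          + (if B \<in> compact_sets m \<and> C \<in> compact_sets m then hausdorff_dist m B C else 0)"
      using Sup_Inf_mdist_triangle[of A m B C] Sup_Inf_mdist_triangle[of C m B A]
      unfolding hd by simp linarith
  qed
qed

lemma mspace_hyperspace [simp]: "mspace (hyperspace m) = compact_sets m"
  unfolding hyperspace_def by (rule Metric_space.mspace_metric[OF Metric_space_hyperspace])

lemma mdist_hyperspace:
  "A \<in> compact_sets m \<Longrightarrow> B \<in> compact_sets m \<Longrightarrow> mdist (hyperspace m) A B = hausdorff_dist m A B"
  unfolding hyperspace_def by (simp add: Metric_space.mdist_metric[OF Metric_space_hyperspace])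


section \<open>The regular tree and its path metric\<close>

text \<open>
  A simple graph is a symmetric loop-free relation on the vertex set
  (\<^locale>\<open>pair_bidirected_digraph\<close>). In such a digraph \<^const>\<open>pre_digraph.cycle\<close> also holds for the
  back-and-forth walk along a single edge, so acyclicity only excludes cycles of length at least 3.
\<close>

locale regular_tree = pair_bidirected_digraph G for G :: "'a pair_pre_digraph" +
  fixes k :: nat
  assumes connected: "Digraph_Component.connected (with_proj G)"
    and acyclic: "\<nexists>p. pre_digraph.cycle (with_proj G) p \<and> length p \<ge> 3"
    and regular: "v \<in> pverts G \<Longrightarrow> finite {w. (v, w) \<in> parcs G} \<and> card {w. (v, w) \<in> parcs G} = k"

definition path_dist :: "'a pair_pre_digraph \<Rightarrow> 'a \<Rightarrow> 'a \<Rightarrow> nat" where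
  "path_dist G u v = (LEAST n. \<exists>p. pre_digraph.awalk (with_proj G) u p v \<and> length p = n)"

definition path_metric :: "'a pair_pre_digraph \<Rightarrow> 'a metric" where
  "path_metric G = metric (pverts G, \<lambda>u v. real (path_dist G u v))"

context pair_sym_digraph
begin

lemma path_dist_le: "awalk u p v \<Longrightarrow> path_dist G u v \<le> length p"
  unfolding path_dist_def by (rule Least_le) blast

lemma path_dist_attained:
  assumes "awalk u p v"
  obtains q where "awalk u q v" "length q = path_dist G u v"
  using LeastI[of "\<lambda>n. \<exists>p. awalk u p v \<and> length p = n" "length p"] assms
  unfolding path_dist_def by blast

lemma length_rev_path: "length (rev_path p) = length p"
  by (induction p) auto

lemma path_dist_commute: "path_dist G u v = path_dist G v u"
proof -
  have "(\<exists>p. awalk u p v \<and> length p = n) \<longleftrightarrow> (\<exists>p. awalk v p u \<and> length p = n)" for n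
    using awalk_rev_path' length_rev_path by metis
  then show ?thesis unfolding path_dist_def by presburger
qed

lemma connected_imp_awalk:
  assumes "Digraph_Component.connected (with_proj G)" "u \<in> pverts G" "v \<in> pverts G"
  obtains p where "awalk u p v"
proof -
  have "strongly_connected (with_proj G)"
    by (rule symmetric_connected_imp_strongly_connected[OF pair_sym_arcs assms(1)])
  then have "u \<rightarrow>\<^sup>*\<^bsub>with_proj G\<^esub> v"
    using assms(2,3) unfolding strongly_connected_def by auto
  then show ?thesis using that reachable_awalk by blast
qed

lemma Metric_space_path_dist:
  assumes con: "Digraph_Component.connected (with_proj G)"
  shows "Metric_space (pverts G) (\<lambda>u v. real (path_dist G u v))"
proof
  fix u v
  show "0 \<le> real (path_dist G u v)" by simp
  show "real (path_dist G u v) = real (path_dist G v u)" using path_dist_commute by simp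
next
  fix u v assume uv: "u \<in> pverts G" "v \<in> pverts G"
  show "(real (path_dist G u v) = 0) = (u = v)"
  proof
    assume "real (path_dist G u v) = 0"
    then show "u = v"
      using path_dist_attained connected_imp_awalk[OF con uv] awalk_empty_ends
      by (metis length_0_conv of_nat_eq_0_iff)
  next
    assume "u = v"
    then show "real (path_dist G u v) = 0"
      using path_dist_le[of u "[]" v] uv awalk_Nil_iff by auto
  qed
next
  fix u v w assume V: "u \<in> pverts G" "v \<in> pverts G" "w \<in> pverts G"
  obtain p where p: "awalk u p v" "length p = path_dist G u v"
    using path_dist_attained connected_imp_awalk[OF con V(1,2)] by metis
  obtain q where q: "awalk v q w" "length q = path_dist G v w"
    using path_dist_attained connected_imp_awalk[OF con V(2,3)] by metis
  have "path_dist G u w \<le> length (p @ q)"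
    using path_dist_le awalk_appendI p(1) q(1) by blast
  then show "real (path_dist G u w) \<le> real (path_dist G u v) + real (path_dist G v w)"
    using p(2) q(2) by simp
qed

end

context regular_tree
begin

lemma mspace_path_metric [simp]: "mspace (path_metric G) = pverts G"
  unfolding path_metric_def by (rule Metric_space.mspace_metric[OF Metric_space_path_dist[OF connected]])

lemma mdist_path_metric [simp]: "mdist (path_metric G) = (\<lambda>u v. real (path_dist G u v))"
  unfolding path_metric_def by (simp add: Metric_space.mdist_metric[OF Metric_space_path_dist[OF connected]])

lemma compact_sets_path_metric:
  "compact_sets (path_metric G) = {A. A \<noteq> {} \<and> finite A \<and> A \<subseteq> pverts G}"
proof -
  interpret M: Metric_space "pverts G" "\<lambda>u v. real (path_dist G u v)"
    by (rule Metric_space_path_dist[OF connected])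
  have "openin M.mtopology {v}" if v: "v \<in> pverts G" for v
  proof -
    have "M.mball v 1 = {v}"
      using v M.zero by fastforce
    then show ?thesis by (metis M.openin_mball)
  qed
  then have "M.mtopology = discrete_topology (pverts G)"
    by (metis M.topspace_mtopology discrete_topology_unique)
  moreover have "mtopology_of (path_metric G) = M.mtopology"
    unfolding mtopology_of_def by simp
  ultimately show ?thesis
    unfolding compact_sets_def by (auto simp: compactin_discrete_topology)
qed

end

end

theory Submission
  imports Defs
begin

text \<open>
  Write \<open>K\<close> for the hyperspace of the tree, whose points are the nonempty finite sets of vertices. Balls in
  \<open>K\<close> are finite, because the tree is locally finite, and a nonexpansive injection \<open>F\<close> maps the ball
  of radius \<open>r\<close> around \<open>A\<close> injectively into the ball of radius \<open>r\<close> around \<open>F A\<close>. So \<open>F\<close> can only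
  move a point to one with balls at least as large, and wherever the two balls have equally many points, \<open>F\<close>
  maps the first onto the second. The whole proof is an exploitation of this counting principle.

  For radius 1, the sets near \<open>A\<close> are the sets of vertices that lie within distance 1 of \<open>A\<close> and meet
  the closed neighbourhood of each point of \<open>A\<close>. For a singleton these are the nonempty
  subsets of a set with \<open>k + 1\<close> points, and for every other \<open>A\<close> there are strictly more of them
  (\<open>card_ball_K_1_less\<close>). Hence the preimage of a singleton under \<open>F\<close> is a singleton, say
  \<open>F {g v} = {v}\<close> (with \<open>g\<close> called \<open>pre_vertex\<close> below), and \<open>F\<close> maps the unit ball around \<open>{g v}\<close> onto the one around \<open>{v}\<close>. Therefore
  \<open>g\<close> preserves adjacency. Being injective, it is a bijection between the \<open>k\<close> neighbours of \<open>v\<close> and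
  the \<open>k\<close> neighbours of \<open>g v\<close>, so its image is closed under adjacency and, by connectedness, is the whole
  tree. It is an isometry: it does not increase distances because it preserves edges, and it does not decrease
  them because \<open>F\<close> is nonexpansive. The inverse of \<open>g\<close> is the isometry that induces \<open>F\<close> on singletons.

  For arbitrary radius \<open>r\<close>, taking images under \<open>g\<close> is an isometry from the ball around \<open>{v}\<close> onto the ball
  around \<open>{g v}\<close>. So these balls have equally many points, and \<open>F\<close> maps the second onto the first.
  Two isometric finite metric spaces have the same sum of all distances, so a nonexpansive bijection
  between them cannot shrink any distance (\<open>nonexpansive_bij_finite_imp_isometric\<close>). Any two points of
  \<open>K\<close> lie in a common ball of this kind, and so \<open>F\<close> is an isometry.
\<close>

(* Balls of radius 1 are compared syntactically below, so the radius should not become Suc 0. *)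
declare One_nat_def [simp del]

section \<open>Nonexpansive bijections between isometric finite spaces\<close>

text \<open>
  Reindexing along \<open>F\<close> and along \<open>h\<close> shows that the distances between images sum to the total of all
  distances in \<open>Y\<close>, hence in \<open>X\<close>; as no term grows under \<open>F\<close>, no term can shrink either. Comparing
  with a second space, instead of with \<open>X\<close> itself, makes it possible to treat an \<open>F\<close> that moves balls around.
\<close>

lemma nonexpansive_bij_finite_imp_isometric:
  fixes dX :: "'a \<Rightarrow> 'a \<Rightarrow> real" and dY :: "'b \<Rightarrow> 'b \<Rightarrow> real"
  assumes fin: "finite X" and F: "bij_betw F X Y" and h: "bij_betw h X Y"
    and iso: "\<And>x y. x \<in> X \<Longrightarrow> y \<in> X \<Longrightarrow> dY (h x) (h y) = dX x y"
    and le: "\<And>x y. x \<in> X \<Longrightarrow> y \<in> X \<Longrightarrow> dY (F x) (F y) \<le> dX x y"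
    and xy: "x \<in> X" "y \<in> X"
  shows "dY (F x) (F y) = dX x y"
proof -
  have bij: "bij_betw (\<lambda>(x, y). (f x, f y)) (X \<times> X) (Y \<times> Y)" if "bij_betw f X Y" for f
    using that unfolding bij_betw_def inj_on_def by force
  have total: "(\<Sum>(x, y)\<in>X \<times> X. dY (f x) (f y)) = (\<Sum>(u, v)\<in>Y \<times> Y. dY u v)"
    if "bij_betw f X Y" for f
    using sum.reindex_bij_betw[OF bij[OF that], of "\<lambda>(u, v). dY u v"]
    by (simp add: case_prod_unfold)
  have "(\<Sum>(x, y)\<in>X \<times> X. dX x y) = (\<Sum>(x, y)\<in>X \<times> X. dY (h x) (h y))"
    by (rule sum.cong) (auto simp: iso)
  then have eq: "(\<Sum>p\<in>X \<times> X. dX (fst p) (snd p) - dY (F (fst p)) (F (snd p))) = 0"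
    using total[OF F] total[OF h] by (simp add: sum_subtractf case_prod_unfold)
  have "dX (fst p) (snd p) - dY (F (fst p)) (F (snd p)) = 0" if "p \<in> X \<times> X" for p
    using eq that fin le by (subst (asm) sum_nonneg_eq_0_iff) auto
  from this[of "(x, y)"] xy show ?thesis by simp
qed

section \<open>The Hausdorff distance between finite sets\<close>

lemma hausdorff_dist_le_iff:
  assumes "finite A" "A \<noteq> {}" "finite B" "B \<noteq> {}"
  shows "hausdorff_dist m A B \<le> r \<longleftrightarrow>
    (\<forall>a\<in>A. \<exists>b\<in>B. mdist m a b \<le> r) \<and> (\<forall>b\<in>B. \<exists>a\<in>A. mdist m a b \<le> r)"
  using assms by (simp add: hausdorff_dist_def cSup_eq_Max cInf_eq_Min Min_le_iff)

lemma hausdorff_dist_image: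
  assumes "finite A" "A \<noteq> {}" "finite B" "B \<noteq> {}"
    and iso: "\<And>a b. a \<in> A \<Longrightarrow> b \<in> B \<Longrightarrow> mdist m' (g a) (g b) = mdist m a b"
  shows "hausdorff_dist m' (g ` A) (g ` B) = hausdorff_dist m A B"
proof -
  have "hausdorff_dist m' (g ` A) (g ` B) \<le> r \<longleftrightarrow> hausdorff_dist m A B \<le> r" for r
    using assms by (simp add: hausdorff_dist_le_iff)
  then show ?thesis by (metis order_antisym order_refl)
qed

section \<open>Balls in the tree\<close>

context regular_tree
begin

abbreviation dist_T :: "'a \<Rightarrow> 'a \<Rightarrow> nat" where
  "dist_T \<equiv> path_dist G"

abbreviation dist_K :: "'a set \<Rightarrow> 'a set \<Rightarrow> real" where
  "dist_K \<equiv> hausdorff_dist (path_metric G)"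

abbreviation K :: "'a set set" where
  "K \<equiv> compact_sets (path_metric G)"

definition ball_T :: "'a \<Rightarrow> nat \<Rightarrow> 'a set" where
  "ball_T v r = {w \<in> pverts G. dist_T v w \<le> r}"

definition ball_K :: "'a set \<Rightarrow> nat \<Rightarrow> 'a set set" where
  "ball_K A r = {B \<in> K. dist_K A B \<le> r}"

lemma dist_T_triangle:
  "u \<in> pverts G \<Longrightarrow> v \<in> pverts G \<Longrightarrow> w \<in> pverts G \<Longrightarrow> dist_T u w \<le> dist_T u v + dist_T v w"
  using Metric_space.triangle[OF Metric_space_path_dist[OF connected], of u v w] by linarith

lemma dist_T_zero: "u \<in> pverts G \<Longrightarrow> v \<in> pverts G \<Longrightarrow> dist_T u v = 0 \<longleftrightarrow> u = v"
  using Metric_space.zero[OF Metric_space_path_dist[OF connected], of u v] by simp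

lemma dist_T_le_1_iff:
  assumes "u \<in> pverts G" "v \<in> pverts G"
  shows "dist_T u v \<le> 1 \<longleftrightarrow> u = v \<or> (u, v) \<in> parcs G"
proof
  assume le: "dist_T u v \<le> 1"
  obtain p where "awalk u p v" "length p = dist_T u v"
    using path_dist_attained connected_imp_awalk[OF connected assms] by metis
  then have "length p \<le> 1" using le by simp
  then consider "p = []" | e where "p = [e]"
    by (cases p) (auto simp: One_nat_def)
  then show "u = v \<or> (u, v) \<in> parcs G"
    using \<open>awalk u p v\<close> by cases (auto simp: awalk_simps)
next
  assume "u = v \<or> (u, v) \<in> parcs G"
  then have "awalk u [] v \<or> awalk u [(u, v)] v"
    using assms by (auto simp: awalk_simps)
  then show "dist_T u v \<le> 1"
    using path_dist_le[of u "[]" v] path_dist_le[of u "[(u, v)]" v] by auto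
qed

lemma dist_T_Suc_step:
  assumes "u \<in> pverts G" "v \<in> pverts G" "dist_T u v = Suc n"
  obtains w where "(u, w) \<in> parcs G" "dist_T w v \<le> n"
proof -
  obtain p where p: "awalk u p v" "length p = Suc n"
    using path_dist_attained connected_imp_awalk[OF connected assms(1,2)] assms(3) by metis
  then obtain e q where "p = e # q" by (cases p) auto
  with p have "(u, snd e) \<in> parcs G" "awalk (snd e) q v" "length q = n"
    by (cases e; auto simp: awalk_simps)+
  then show thesis using that path_dist_le by blast
qed

text \<open>
  Acyclicity is used in this form: the neighbourhoods of two adjacent vertices are disjoint, which
  makes their closed neighbourhoods incomparable as soon as \<open>k \<ge> 2\<close>.
\<close>

lemma no_triangle:
  assumes "(u, v) \<in> parcs G" "(v, w) \<in> parcs G" "(u, w) \<in> parcs G"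
  shows False
proof -
  have "(w, u) \<in> parcs G" using assms(3) by (simp add: arcs_symmetric)
  moreover have "u \<noteq> v" "v \<noteq> w" "w \<noteq> u" using pair_no_loops assms by fastforce+
  ultimately have "cycle [(u, v), (v, w), (w, u)]"
    using assms by (auto simp: cycle_def awalk_simps in_arcsD1)
  with acyclic show False by force
qed

lemma ball_T_1: "v \<in> pverts G \<Longrightarrow> ball_T v 1 = insert v {w. (v, w) \<in> parcs G}"
  using dist_T_le_1_iff in_arcsD2 by (auto simp: ball_T_def)

lemma card_ball_T_1:
  assumes "v \<in> pverts G"
  shows "finite (ball_T v 1)" "card (ball_T v 1) = Suc k"
proof -
  have "(v, v) \<notin> parcs G" using pair_no_loops[of "(v, v)"] by auto
  then show "finite (ball_T v 1)" "card (ball_T v 1) = Suc k"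
    using regular[OF assms] assms by (simp_all add: ball_T_1)
qed

lemma finite_ball_T: "v \<in> pverts G \<Longrightarrow> finite (ball_T v r)"
proof (induction r arbitrary: v)
  case 0
  then have "ball_T v 0 \<subseteq> {v}" by (auto simp: ball_T_def dist_T_zero)
  then show ?case using finite_subset by blast
next
  case (Suc r)
  have "ball_T v (Suc r) \<subseteq> ball_T v r \<union> (\<Union>w\<in>{w. (v, w) \<in> parcs G}. ball_T w r)"
  proof
    fix x assume x: "x \<in> ball_T v (Suc r)"
    show "x \<in> ball_T v r \<union> (\<Union>w\<in>{w. (v, w) \<in> parcs G}. ball_T w r)"
    proof (cases "dist_T v x = Suc r")
      case True
      with x Suc.prems dist_T_Suc_step[of v x r] show ?thesis
        unfolding ball_T_def by blast
    next
      case False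
      with x show ?thesis by (auto simp: ball_T_def)
    qed
  qed
  moreover have "finite {w. (v, w) \<in> parcs G}" using regular Suc.prems by blast
  ultimately show ?case
    using Suc.IH Suc.prems in_arcsD2 by (auto intro: finite_subset)
qed

section \<open>Balls in the hyperspace\<close>

lemma dist_K_le_iff:
  assumes "A \<in> K" "B \<in> K"
  shows "dist_K A B \<le> real r \<longleftrightarrow>
    (\<forall>a\<in>A. \<exists>b\<in>B. dist_T a b \<le> r) \<and> (\<forall>b\<in>B. \<exists>a\<in>A. dist_T a b \<le> r)"
  using assms by (subst hausdorff_dist_le_iff) (auto simp: compact_sets_path_metric)

lemma finite_ball_K:
  assumes "A \<in> K"
  shows "finite (ball_K A r)"
proof -
  have "ball_K A r \<subseteq> Pow (\<Union>a\<in>A. ball_T a r)"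
  proof
    fix B assume "B \<in> ball_K A r"
    then have B: "B \<in> K" "\<forall>b\<in>B. \<exists>a\<in>A. dist_T a b \<le> r"
      using dist_K_le_iff[OF assms] by (auto simp: ball_K_def)
    then show "B \<in> Pow (\<Union>a\<in>A. ball_T a r)"
      using compact_sets_subset by (fastforce simp: ball_T_def)
  qed
  moreover have "finite (Pow (\<Union>a\<in>A. ball_T a r))"
    using assms finite_ball_T by (auto simp: compact_sets_path_metric)
  ultimately show ?thesis by (rule finite_subset)
qed

lemma ball_K_singleton:
  assumes "v \<in> pverts G"
  shows "ball_K {v} r = Pow (ball_T v r) - {{}}"
proof -
  have v: "{v} \<in> K" using assms by (simp add: compact_sets_path_metric)
  have "B \<in> ball_K {v} r \<longleftrightarrow> B \<subseteq> ball_T v r \<and> B \<noteq> {}" for B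
  proof (cases "B \<in> K")
    case True
    then show ?thesis
      using dist_K_le_iff[OF v True, of r]
      by (auto simp: ball_K_def ball_T_def compact_sets_path_metric)
  next
    case False
    then show ?thesis
      using finite_subset[OF _ finite_ball_T[OF assms, of r], of B]
      by (auto simp: ball_K_def ball_T_def compact_sets_path_metric)
  qed
  then show ?thesis by blast
qed

lemma card_ball_K_1_singleton:
  assumes "v \<in> pverts G"
  shows "card (ball_K {v} 1) = 2 ^ Suc k - 1"
  using assms by (simp add: ball_K_singleton card_ball_T_1 card_Pow)

text \<open>
  Let \<open>N\<close> be the set of vertices within distance 1 of \<open>A\<close>. A subset of \<open>N\<close> belongs to the unit ball around \<open>A\<close>
  if it meets the closed neighbourhood of each point of \<open>A\<close>. Fix \<open>a\<close> in \<open>A\<close>. Each other point of \<open>A\<close> has a vertex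
  outside the closed neighbourhood of \<open>a\<close> in its own: itself if it is not adjacent to \<open>a\<close>, and
  otherwise a second neighbour, which exists because \<open>k \<ge> 2\<close> and is not adjacent to \<open>a\<close> because there are no
  triangles. So adding to a nonempty subset of the closed neighbourhood of \<open>a\<close> all of \<open>N\<close> outside that neighbourhood
  gives a member of the unit ball around \<open>A\<close>, and nothing is lost in doing so. This embeds the
  unit ball around \<open>{a}\<close>. It misses the sets \<open>N - {x}\<close> with \<open>x\<close> outside the closed neighbourhood of \<open>a\<close>,
  which are members because closed neighbourhoods have more than one point.
\<close>

lemma card_ball_K_1_less:
  assumes k: "k \<ge> 2" and A: "A \<in> K" "\<nexists>a. A = {a}" and v: "v \<in> pverts G"
  shows "card (ball_K {v} 1) < card (ball_K A 1)"
proof -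
  have AV: "A \<subseteq> pverts G" "finite A" "A \<noteq> {}" using A(1) by (auto simp: compact_sets_path_metric)
  then obtain a a' where a: "a \<in> A" "a' \<in> A" "a \<noteq> a'" using A(2) by blast
  define N where "N = (\<Union>c\<in>A. ball_T c 1)"
  have N: "finite N" "N \<subseteq> pverts G"
    using AV card_ball_T_1 by (auto simp: N_def ball_T_def)
  have dominating: "B \<in> ball_K A 1" if "B \<subseteq> N" "\<And>c. c \<in> A \<Longrightarrow> B \<inter> ball_T c 1 \<noteq> {}" for B
  proof -
    have "B \<in> K" using that a N finite_subset[of B N] by (auto simp: compact_sets_path_metric)
    then show ?thesis
      using that unfolding ball_K_def N_def ball_T_def
      by (simp add: dist_K_le_iff[OF A(1), of _ 1, unfolded of_nat_1]) blast
  qed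
  have outside: "\<exists>x. x \<in> ball_T c 1 \<and> x \<notin> ball_T a 1" if c: "c \<in> A" "c \<noteq> a" for c
  proof (cases "(a, c) \<in> parcs G")
    case True
    have cV: "c \<in> pverts G" using c AV by blast
    have "\<not> {w. (c, w) \<in> parcs G} \<subseteq> {a}"
      using regular[OF cV] k card_mono[of "{a}" "{w. (c, w) \<in> parcs G}"] by auto
    then obtain x where "(c, x) \<in> parcs G" "x \<noteq> a" by auto
    then show ?thesis
      using True no_triangle[of a c x] cV AV a by (intro exI[of _ x]) (auto simp: ball_T_1)
  next
    case False
    then show ?thesis
      using c AV a by (intro exI[of _ c]) (auto simp: ball_T_1)
  qed
  \<comment> \<open>Adding \<open>R\<close> takes care of every point of \<open>A\<close> other than \<open>a\<close>.\<close>
  define R where "R = N - ball_T a 1"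
  define \<phi> where "\<phi> C = C \<union> R" for C
  have aN: "ball_T a 1 \<subseteq> N" using a by (auto simp: N_def)
  have \<phi>_ball: "\<phi> C \<in> ball_K A 1" if "C \<in> ball_K {a} 1" for C
  proof (rule dominating)
    have "a \<in> pverts G" using a AV by blast
    then have C: "C \<subseteq> ball_T a 1" "C \<noteq> {}" using that ball_K_singleton by blast+
    then show "\<phi> C \<subseteq> N" using aN by (auto simp: \<phi>_def R_def)
    show "\<phi> C \<inter> ball_T c 1 \<noteq> {}" if "c \<in> A" for c
    proof (cases "c = a")
      case False
      then obtain x where "x \<in> ball_T c 1" "x \<notin> ball_T a 1" using outside \<open>c \<in> A\<close> by blast
      then show ?thesis using \<open>c \<in> A\<close> by (auto simp: \<phi>_def R_def N_def)
    qed (use C in \<open>auto simp: \<phi>_def\<close>)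
  qed
  have inj: "inj_on \<phi> (ball_K {a} 1)"
  proof (rule inj_on_inverseI)
    fix C assume "C \<in> ball_K {a} 1"
    then have "C \<subseteq> ball_T a 1" using a AV ball_K_singleton[of a 1] by blast
    then show "\<phi> C \<inter> ball_T a 1 = C" by (auto simp: \<phi>_def R_def)
  qed
  obtain x where x: "x \<in> ball_T a' 1" "x \<notin> ball_T a 1" using outside a by metis
  then have xR: "x \<in> R" using a by (auto simp: R_def N_def)
  have "N - {x} \<in> ball_K A 1"
  proof (rule dominating)
    fix c assume c: "c \<in> A"
    have "\<not> ball_T c 1 \<subseteq> {x}"
      using card_ball_T_1[of c] c AV k card_mono[of "{x}" "ball_T c 1"] by auto
    then show "(N - {x}) \<inter> ball_T c 1 \<noteq> {}" using c by (auto simp: N_def)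
  qed auto
  moreover have "N - {x} \<notin> \<phi> ` ball_K {a} 1" using xR by (auto simp: \<phi>_def)
  ultimately have "\<phi> ` ball_K {a} 1 \<subset> ball_K A 1" using \<phi>_ball by blast
  then have "card (ball_K {a} 1) < card (ball_K A 1)"
    using psubset_card_mono[OF finite_ball_K[OF A(1)]] card_image[OF inj] by metis
  then show ?thesis using card_ball_K_1_singleton[of a] card_ball_K_1_singleton[OF v] a AV by auto
qed

section \<open>Adjacency-preserving maps of the tree\<close>

lemma adjacency_preserving_imp_nonexpansive:
  assumes g: "\<And>v. v \<in> pverts G \<Longrightarrow> g v \<in> pverts G"
    and adj: "\<And>u v. (u, v) \<in> parcs G \<Longrightarrow> (g u, g v) \<in> parcs G"
  shows "u \<in> pverts G \<Longrightarrow> v \<in> pverts G \<Longrightarrow> dist_T (g u) (g v) \<le> dist_T u v"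
proof (induction "dist_T u v" arbitrary: u rule: less_induct)
  case less
  show ?case
  proof (cases "dist_T u v")
    case 0
    then have "u = v" using dist_T_zero less.prems by blast
    then have "dist_T (g u) (g v) = 0"
      using dist_T_zero[OF g[OF less.prems(1)] g[OF less.prems(2)]] by simp
    then show ?thesis by simp
  next
    case (Suc n)
    then obtain w where w: "(u, w) \<in> parcs G" "dist_T w v \<le> n"
      using dist_T_Suc_step less.prems by metis
    have wV: "w \<in> pverts G" using in_arcsD2 w(1) .
    have "dist_T (g u) (g w) \<le> 1"
      using adj[OF w(1)] dist_T_le_1_iff[OF g[OF less.prems(1)] g[OF wV]] by simp
    moreover have "dist_T (g w) (g v) \<le> n"
      using less.hyps[of w] wV w(2) Suc less.prems(2) by simp
    ultimately show ?thesis
      using dist_T_triangle[OF g[OF less.prems(1)] g[OF wV] g[OF less.prems(2)]] Suc by linarith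
  qed
qed

text \<open>
  By regularity, injectivity on the finitely many neighbours of \<open>x\<close> forces all neighbours of \<open>g x\<close> into the image;
  the image is thus closed under adjacency, and a shortest walk reaches every vertex from it.
\<close>

lemma adjacency_preserving_inj_imp_surj:
  assumes g: "\<And>v. v \<in> pverts G \<Longrightarrow> g v \<in> pverts G"
    and adj: "\<And>u v. (u, v) \<in> parcs G \<Longrightarrow> (g u, g v) \<in> parcs G"
    and inj: "inj_on g (pverts G)"
  shows "g ` pverts G = pverts G"
proof
  show "pverts G \<subseteq> g ` pverts G"
  proof
    fix v assume v: "v \<in> pverts G"
    have closed: "w \<in> g ` pverts G" if "x \<in> pverts G" "(g x, w) \<in> parcs G" for x w
    proof -
      let ?N = "\<lambda>x. {w. (x, w) \<in> parcs G}"
      have "inj_on g (?N x)" using inj in_arcsD2 by (auto intro: inj_on_subset)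
      then have "card (g ` ?N x) = card (?N (g x))"
        using regular[OF that(1)] regular[OF g[OF that(1)]] by (simp add: card_image)
      then have "g ` ?N x = ?N (g x)"
        using regular[OF g[OF that(1)]] adj by (intro card_subset_eq) auto
      then have "w \<in> g ` ?N x" using that(2) by simp
      then show ?thesis using in_arcsD2 by blast
    qed
    have "u \<in> pverts G \<Longrightarrow> u \<in> g ` pverts G \<Longrightarrow> v \<in> g ` pverts G" for u
    proof (induction "dist_T u v" arbitrary: u rule: less_induct)
      case less
      show ?case
      proof (cases "dist_T u v")
        case 0
        then show ?thesis using dist_T_zero less.prems v by auto
      next
        case (Suc n)
        then obtain w where w: "(u, w) \<in> parcs G" "dist_T w v \<le> n"
          using dist_T_Suc_step less.prems v by metis
        then have "w \<in> g ` pverts G" using closed less.prems by auto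
        then show ?thesis using less.hyps[of w] w Suc in_arcsD2 by auto
      qed
    qed
    from this[OF g[OF v] imageI[OF v]] show "v \<in> g ` pverts G" .
  qed
qed (rule image_subsetI[OF g])

end

section \<open>Nonexpansive bijections of the hyperspace\<close>

locale nonexpansive_bijection = regular_tree +
  fixes F :: "'a set \<Rightarrow> 'a set"
  assumes degree: "k \<ge> 2"
    and bij: "bij_betw F K K"
    and nonexpansive: "A \<in> K \<Longrightarrow> B \<in> K \<Longrightarrow> dist_K (F A) (F B) \<le> dist_K A B"
begin

lemma singleton_in_K [simp]: "{v} \<in> K \<longleftrightarrow> v \<in> pverts G"
  by (simp add: compact_sets_path_metric)

lemma F_in_K: "A \<in> K \<Longrightarrow> F A \<in> K"
  using bij by (auto simp: bij_betw_def)

lemma F_inj: "F A = F B \<Longrightarrow> A \<in> K \<Longrightarrow> B \<in> K \<Longrightarrow> A = B"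
  using bij by (auto simp: bij_betw_def inj_on_def)

lemma F_ball_subset: "A \<in> K \<Longrightarrow> F ` ball_K A r \<subseteq> ball_K (F A) r"
  using nonexpansive F_in_K by (fastforce simp: ball_K_def)

lemma F_inj_on_ball: "inj_on F (ball_K A r)"
  using F_inj by (auto simp: ball_K_def inj_on_def)

lemma card_F_ball: "A \<in> K \<Longrightarrow> card (ball_K A r) \<le> card (ball_K (F A) r)"
  using card_mono[OF finite_ball_K[OF F_in_K] F_ball_subset] card_image[OF F_inj_on_ball] by metis

lemma F_ball_onto:
  assumes "A \<in> K" "card (ball_K A r) = card (ball_K (F A) r)"
  shows "F ` ball_K A r = ball_K (F A) r"
  using assms card_subset_eq[OF finite_ball_K[OF F_in_K] F_ball_subset] card_image[OF F_inj_on_ball]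
  by metis

text \<open>
  The unit ball around the preimage embeds into the unit ball around a singleton, and singletons
  are the sets with the smallest unit balls.
\<close>

lemma preimage_of_singleton:
  assumes "v \<in> pverts G"
  shows "\<exists>u. u \<in> pverts G \<and> F {u} = {v}"
proof -
  have "{v} \<in> F ` K" using assms bij by (simp add: bij_betw_def)
  then obtain A where A: "A \<in> K" "F A = {v}" by (metis imageE)
  then have "card (ball_K A 1) \<le> card (ball_K {v} 1)" using card_F_ball by metis
  then obtain u where "A = {u}" using card_ball_K_1_less[OF degree A(1) _ assms] by fastforce
  then show ?thesis using A by auto
qed

text \<open>
  This is the inverse of the isometry of the tree that \<open>F\<close> induces. It is the direction that
  counting gives first: at this stage a singleton is known to come from a singleton, but not
  to be mapped to one.
\<close>

definition pre_vertex :: "'a \<Rightarrow> 'a" where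
  "pre_vertex v = (SOME u. u \<in> pverts G \<and> F {u} = {v})"

lemma pre_vertex:
  assumes "v \<in> pverts G"
  shows "pre_vertex v \<in> pverts G" "F {pre_vertex v} = {v}"
  using someI_ex[OF preimage_of_singleton[OF assms]] by (auto simp: pre_vertex_def)

lemma inj_pre_vertex: "inj_on pre_vertex (pverts G)"
  using pre_vertex by (metis inj_onI singleton_inject)

text \<open>
  Unit balls around singletons all have the same size, so \<open>F\<close> maps one onto the other. The
  preimage of \<open>{v}\<close> therefore lies near the preimage of \<open>{u}\<close>, although \<open>F\<close> itself bounds distances
  in the opposite direction.
\<close>

lemma pre_vertex_adjacent:
  assumes uv: "(u, v) \<in> parcs G"
  shows "(pre_vertex u, pre_vertex v) \<in> parcs G"
proof -
  have V: "u \<in> pverts G" "v \<in> pverts G" using uv in_arcsD1 in_arcsD2 by auto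
  have "F ` ball_K {pre_vertex u} 1 = ball_K {u} 1"
    using F_ball_onto[of "{pre_vertex u}" 1] pre_vertex[OF V(1)] card_ball_K_1_singleton V by simp
  moreover have "{v} \<in> ball_K {u} 1" using uv V by (simp add: ball_K_singleton ball_T_1)
  ultimately obtain B where B: "B \<in> ball_K {pre_vertex u} 1" "F B = {v}" by (metis imageE)
  then have "B = {pre_vertex v}"
    using F_inj[of B "{pre_vertex v}"] pre_vertex[OF V(2)] by (auto simp: ball_K_def)
  then have "pre_vertex v \<in> ball_T (pre_vertex u) 1" using B pre_vertex V by (simp add: ball_K_singleton)
  moreover have "pre_vertex u \<noteq> pre_vertex v"
    using inj_pre_vertex V uv pair_no_loops[of "(u, v)"] by (auto simp: inj_on_def)
  ultimately show ?thesis using pre_vertex V by (simp add: ball_T_1)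
qed

lemma pre_vertex_onto: "pre_vertex ` pverts G = pverts G"
  using adjacency_preserving_inj_imp_surj[OF pre_vertex(1) pre_vertex_adjacent inj_pre_vertex] .

lemma pre_vertex_isometric:
  assumes V: "u \<in> pverts G" "v \<in> pverts G"
  shows "dist_T (pre_vertex u) (pre_vertex v) = dist_T u v"
proof (rule antisym)
  show "dist_T (pre_vertex u) (pre_vertex v) \<le> dist_T u v"
    using adjacency_preserving_imp_nonexpansive[OF pre_vertex(1) pre_vertex_adjacent V] .
  have preV: "{pre_vertex u} \<in> K" "{pre_vertex v} \<in> K" using pre_vertex V by auto
  then have "dist_K {u} {v} \<le> dist_K {pre_vertex u} {pre_vertex v}"
    using nonexpansive[OF preV] pre_vertex V by metis
  then show "dist_T u v \<le> dist_T (pre_vertex u) (pre_vertex v)" by (simp add: hausdorff_dist_def)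
qed

lemma image_pre_vertex_ball_T:
  assumes "v \<in> pverts G"
  shows "pre_vertex ` ball_T v r = ball_T (pre_vertex v) r"
proof -
  have "ball_T (pre_vertex v) r = {w \<in> pre_vertex ` pverts G. dist_T (pre_vertex v) w \<le> r}"
    by (simp add: ball_T_def pre_vertex_onto)
  also have "\<dots> = pre_vertex ` ball_T v r"
    using pre_vertex_isometric[OF assms] by (auto simp: ball_T_def image_iff)
  finally show ?thesis by simp
qed

lemma image_pre_vertex_ball_K:
  assumes "v \<in> pverts G"
  shows "bij_betw (image pre_vertex) (ball_K {v} r) (ball_K {pre_vertex v} r)"
proof -
  have "inj_on (image pre_vertex) (ball_K {v} r)"
  proof (rule inj_on_subset)
    show "inj_on (image pre_vertex) (Pow (pverts G))" by (rule inj_on_image_Pow[OF inj_pre_vertex])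
    show "ball_K {v} r \<subseteq> Pow (pverts G)"
      unfolding ball_K_singleton[OF assms] by (auto simp: ball_T_def)
  qed
  moreover have "image pre_vertex ` (Pow (ball_T v r) - {{}}) = Pow (ball_T (pre_vertex v) r) - {{}}"
  proof -
    have "image pre_vertex ` Pow (ball_T v r) = Pow (ball_T (pre_vertex v) r)"
      by (rule image_Pow_surj[OF image_pre_vertex_ball_T[OF assms]])
    moreover have "image pre_vertex ` (P - {{}}) = image pre_vertex ` P - {{}}" for P by blast
    ultimately show ?thesis by metis
  qed
  ultimately show ?thesis using assms pre_vertex by (simp add: bij_betw_def ball_K_singleton)
qed

text \<open>
  A large ball around a singleton \<open>{pre_vertex v}\<close> contains both sets, and \<open>F\<close> maps it onto the ball
  around \<open>{v}\<close>, which is isometric to it by the inverse of \<open>image pre_vertex\<close>; the summation argument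
  for finite spaces then applies.
\<close>

lemma F_isometric:
  assumes AB: "A \<in> K" "B \<in> K"
  shows "dist_K (F A) (F B) = dist_K A B"
proof -
  have fin: "finite (A \<union> B)" and sub: "A \<union> B \<subseteq> pverts G" and ne: "A \<noteq> {}" "B \<noteq> {}"
    using AB by (auto simp: compact_sets_path_metric)
  obtain w where w: "w \<in> A" using ne by blast
  have "w \<in> pre_vertex ` pverts G" using w sub pre_vertex_onto by auto
  then obtain v where v: "v \<in> pverts G" "w = pre_vertex v" by blast
  define r where "r = Max (dist_T w ` (A \<union> B))"
  have "dist_T w x \<le> r" if "x \<in> A \<union> B" for x using that fin by (simp add: r_def)
  then have "A \<union> B \<subseteq> ball_T (pre_vertex v) r" using sub v by (auto simp: ball_T_def)
  then have mem: "A \<in> ball_K {pre_vertex v} r" "B \<in> ball_K {pre_vertex v} r"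
    using ne pre_vertex v by (auto simp: ball_K_singleton)
  have card: "card (ball_K {pre_vertex v} r) = card (ball_K {v} r)"
    using bij_betw_same_card[OF image_pre_vertex_ball_K[OF v(1)]] by simp
  have F: "bij_betw F (ball_K {pre_vertex v} r) (ball_K {v} r)"
    using F_ball_onto[of "{pre_vertex v}" r] pre_vertex[OF v(1)] card F_inj_on_ball by (simp add: bij_betw_def)
  have h: "bij_betw (the_inv_into (ball_K {v} r) (image pre_vertex)) (ball_K {pre_vertex v} r) (ball_K {v} r)"
    using bij_betw_the_inv_into image_pre_vertex_ball_K[OF v(1)] by blast
  have iso: "dist_K (pre_vertex ` C) (pre_vertex ` D) = dist_K C D" if "C \<in> K" "D \<in> K" for C D
    using that pre_vertex_isometric
    by (intro hausdorff_dist_image) (auto simp: compact_sets_path_metric subset_iff)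
  show ?thesis
  proof (rule nonexpansive_bij_finite_imp_isometric[OF _ F h _ _ mem])
    show "finite (ball_K {pre_vertex v} r)" using finite_ball_K pre_vertex v by simp
    fix C D assume CD: "C \<in> ball_K {pre_vertex v} r" "D \<in> ball_K {pre_vertex v} r"
    show "dist_K (F C) (F D) \<le> dist_K C D" using CD nonexpansive by (auto simp: ball_K_def)
    let ?h = "the_inv_into (ball_K {v} r) (image pre_vertex)"
    have "?h C \<in> K" "?h D \<in> K" using CD h bij_betwE by (force simp: ball_K_def)+
    moreover have "pre_vertex ` ?h C = C" "pre_vertex ` ?h D = D"
      using CD f_the_inv_into_f_bij_betw[OF image_pre_vertex_ball_K[OF v(1)]] by auto
    ultimately show "dist_K (?h C) (?h D) = dist_K C D" using iso by metis
  qed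
qed

lemma F_singletons: "F ` {{v} | v. v \<in> pverts G} = {{v} | v. v \<in> pverts G}"
proof -
  have singletons: "{{v} | v. v \<in> pverts G} = (\<lambda>v. {v}) ` pverts G" by blast
  have "F ` (\<lambda>v. {v}) ` pverts G = F ` (\<lambda>v. {v}) ` pre_vertex ` pverts G" by (simp add: pre_vertex_onto)
  also have "\<dots> = (\<lambda>v. {v}) ` pverts G"
    unfolding image_image by (rule image_cong[OF refl pre_vertex(2)])
  finally show ?thesis unfolding singletons .
qed

lemma F_induced_by_isometry:
  "\<exists>f. isometry_map (path_metric G) (path_metric G) f \<and> (\<forall>v\<in>pverts G. F {v} = {f v})"
proof (intro exI conjI ballI)
  have pre_vertex_bij: "bij_betw pre_vertex (pverts G) (pverts G)"
    using inj_pre_vertex pre_vertex_onto by (simp add: bij_betw_def)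
  let ?f = "the_inv_into (pverts G) pre_vertex"
  have f_bij: "bij_betw ?f (pverts G) (pverts G)" using bij_betw_the_inv_into[OF pre_vertex_bij] .
  have f: "?f v \<in> pverts G" "pre_vertex (?f v) = v" if "v \<in> pverts G" for v
    using that bij_betwE[OF f_bij] f_the_inv_into_f_bij_betw[OF pre_vertex_bij] by auto
  show "isometry_map (path_metric G) (path_metric G) ?f"
    unfolding isometry_map_def using f_bij f pre_vertex_isometric by simp metis
  show "F {v} = {?f v}" if "v \<in> pverts G" for v
    using pre_vertex(2)[OF f(1)[OF that]] f(2)[OF that] by simp
qed

end

theorem corollary4p16:
  fixes G :: "'a pair_pre_digraph" and k :: nat
  assumes "k \<ge> 2" and "regular_tree G k"
  shows "plastic (hyperspace (path_metric G)) \<and>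
    (\<forall>F. bij_betw F (mspace (hyperspace (path_metric G))) (mspace (hyperspace (path_metric G))) \<and>
         nonexpansive_map (hyperspace (path_metric G)) (hyperspace (path_metric G)) F \<longrightarrow>
       F ` {{v} | v. v \<in> pverts G} = {{v} | v. v \<in> pverts G} \<and>
       (\<exists>f. isometry_map (path_metric G) (path_metric G) f \<and> (\<forall>v\<in>pverts G. F {v} = {f v})))"
proof -
  have nb: "nonexpansive_bijection G k F"
    if "bij_betw F (mspace (hyperspace (path_metric G))) (mspace (hyperspace (path_metric G)))"
      and ne: "nonexpansive_map (hyperspace (path_metric G)) (hyperspace (path_metric G)) F" for F
  proof -
    have FK: "bij_betw F (compact_sets (path_metric G)) (compact_sets (path_metric G))"
      using that(1) by simp
    moreover have "hausdorff_dist (path_metric G) (F A) (F B) \<le> hausdorff_dist (path_metric G) A B"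
      if AB: "A \<in> compact_sets (path_metric G)" "B \<in> compact_sets (path_metric G)" for A B
    proof -
      have "mdist (hyperspace (path_metric G)) (F A) (F B) \<le> mdist (hyperspace (path_metric G)) A B"
        using ne AB by (simp add: nonexpansive_map_def)
      moreover have "F A \<in> compact_sets (path_metric G)" "F B \<in> compact_sets (path_metric G)"
        using AB bij_betwE[OF FK] by auto
      ultimately show ?thesis using AB by (simp add: mdist_hyperspace)
    qed
    ultimately show ?thesis
      using assms by (simp add: nonexpansive_bijection_def nonexpansive_bijection_axioms_def)
  qed
  have iso: "isometry_map (hyperspace (path_metric G)) (hyperspace (path_metric G)) F"
    if "nonexpansive_bijection G k F" for F
  proof -
    interpret nonexpansive_bijection G k F by fact
    show ?thesis
      unfolding isometry_map_def using bij by (simp add: mdist_hyperspace F_in_K F_isometric)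
  qed
  show ?thesis
  proof (intro conjI allI impI)
    show "plastic (hyperspace (path_metric G))"
      unfolding plastic_def using nb iso by blast
    fix F
    assume "bij_betw F (mspace (hyperspace (path_metric G))) (mspace (hyperspace (path_metric G))) \<and>
      nonexpansive_map (hyperspace (path_metric G)) (hyperspace (path_metric G)) F"
    then have F: "nonexpansive_bijection G k F" using nb by blast
    show "F ` {{v} | v. v \<in> pverts G} = {{v} | v. v \<in> pverts G}"
      by (rule nonexpansive_bijection.F_singletons[OF F])
    show "\<exists>f. isometry_map (path_metric G) (path_metric G) f \<and> (\<forall>v\<in>pverts G. F {v} = {f v})"
      by (rule nonexpansive_bijection.F_induced_by_isometry[OF F])
  qed
qed

end
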